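(* (i) If $0<\cos\theta_i\le 1$ for all $i\in\mathcal{V}$, then every eigenvalue $\lambda$ of $\mathcal{L}^{out}$, except the two zero eigenvalues, satisfies $\lambda\in\mathcal{R}^c\cap\{\lambda\in\mathbb{C}:\mathrm{Re}(\lambda)>0\}$. (ii) If $-1\le\cos\theta_i<0$ for all $i\in\mathcal{V}$, then every eigenvalue $\lambda$ of $\mathcal{L}^{out}$, except the two zero eigenvalues, satisfies $\lambda\in\mathcal{R}^c\cap\{\lambda\in\mathbb{C}:\mathrm{Re}(\lambda)<0\}$. (iii) If $\cos\theta_i=0$ for all $i\in\mathcal{V}$, then all the eigenvalues of $\mathcal{L}^{out}$ are located on the imaginary axis.
   Context: Let $\mathcal{G}=(\mathcal{V},\mathcal{E})$ be a connected undirected graph without self-loops on $\mathcal{V}=\{1,\ldots,n\}$, with weights $a_{ij}=a_{ji}\in\{0,1\}$ ($a_{ij}=1$ iff $i$ and $j$ are neighbors, $a_{ii}=0$); $\mathcal{N}_i$ is the set of neighbors of $i$ and $m_i=|\mathcal{N}_i|$. Each agent $i$ has a misalignment angle $\theta_i\in\mathbb{R}$, and $D(\theta)=\begin{bmatrix}\cos\theta & -\sin\theta\\ \sin\theta & \cos\theta\end{bmatrix}$. The matrix $\mathcal{L}^{out}\in\mathbb{R}^{2n\times 2n}$ has $(i,i)$ block $\sum_{j\in\mathcal{N}_i}a_{ij}D(\theta_i)$ and $(i,j)$ block $-a_{ij}D(\theta_i)$ for $j\neq i$. Eigenvalues are counted with algebraic multiplicity. For each $i$ let $$\mathcal{R}^c_i=\{\lambda\in\mathbb{C}:(\mathrm{Re}\lambda-m_i\cos\theta_i)^2+(\mathrm{Im}\lambda+m_i\sin\theta_i)^2\le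 m_i^2\}\cup\{\lambda\in\mathbb{C}:(\mathrm{Re}\lambda-m_i\cos\theta_i)^2+(\mathrm{Im}\lambda-m_i\sin\theta_i)^2\le m_i^2\},$$ and let $\mathcal{R}^c=\bigcup_{i=1}^n\mathcal{R}^c_i$. *)

theory Defs
  imports "Jordan_Normal_Form.Char_Poly" "Graph_Theory.Pair_Digraph"
    "Graph_Theory.Digraph_Component"
begin

text \<open>An undirected graph is a \<open>pair_graph\<close>: a finite, symmetric, loop-free digraph whose arcs are
  pairs of vertices. An undirected edge between \<open>i\<close> and \<open>j\<close> is the pair of arcs
  \<open>(i, j)\<close> and \<open>(j, i)\<close>.\<close>

definition nbrs :: "'a pair_pre_digraph \<Rightarrow> 'a \<Rightarrow> 'a set" where
  "nbrs G i = {j \<in> pverts G. (i, j) \<in> parcs G}"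

definition wt :: "'a pair_pre_digraph \<Rightarrow> 'a \<Rightarrow> 'a \<Rightarrow> real" where
  "wt G i j = (if j \<in> nbrs G i then 1 else 0)"

definition num_nbrs :: "'a pair_pre_digraph \<Rightarrow> 'a \<Rightarrow> real" where
  "num_nbrs G i = real (card (nbrs G i))"

definition rot :: "real \<Rightarrow> real mat" where
  "rot t = mat_of_rows_list 2 [[cos t, - sin t], [sin t, cos t]]"

definition Lout_block :: "'a pair_pre_digraph \<Rightarrow> ('a \<Rightarrow> real) \<Rightarrow> 'a \<Rightarrow> 'a \<Rightarrow> real mat" where
  "Lout_block G \<theta> i j =
     (if i = j then (\<Sum>k\<in>nbrs G i. wt G i k) \<cdot>\<^sub>m rot (\<theta> i)
      else (- wt G i j) \<cdot>\<^sub>m rot (\<theta> i))"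

text \<open>Vertices are numbered from 1, matrix rows and columns from 0: the block of
  vertices \<open>i, j\<close> occupies rows \<open>2(i-1), 2(i-1)+1\<close> and columns \<open>2(j-1), 2(j-1)+1\<close>.\<close>

definition Lout :: "nat \<Rightarrow> nat pair_pre_digraph \<Rightarrow> (nat \<Rightarrow> real) \<Rightarrow> real mat" where
  "Lout n G \<theta> = mat (2 * n) (2 * n) (\<lambda>(r, c).
     Lout_block G \<theta> (r div 2 + 1) (c div 2 + 1) $$ (r mod 2, c mod 2))"

definition Lout_complex :: "nat \<Rightarrow> nat pair_pre_digraph \<Rightarrow> (nat \<Rightarrow> real) \<Rightarrow> complex mat" where
  "Lout_complex n G \<theta> = map_mat complex_of_real (Lout n G \<theta>)"

definition Rc_node :: "'a pair_pre_digraph \<Rightarrow> ('a \<Rightarrow> real) \<Rightarrow> 'a \<Rightarrow> complex set" where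
  "Rc_node G \<theta> i =
     {z. (Re z - num_nbrs G i * cos (\<theta> i))\<^sup>2 + (Im z + num_nbrs G i * sin (\<theta> i))\<^sup>2
           \<le> (num_nbrs G i)\<^sup>2}
   \<union> {z. (Re z - num_nbrs G i * cos (\<theta> i))\<^sup>2 + (Im z - num_nbrs G i * sin (\<theta> i))\<^sup>2
           \<le> (num_nbrs G i)\<^sup>2}"

definition Rc :: "'a pair_pre_digraph \<Rightarrow> ('a \<Rightarrow> real) \<Rightarrow> complex set" where
  "Rc G \<theta> = (\<Union>i\<in>pverts G. Rc_node G \<theta> i)"

end

theory Submission
  imports Defs
begin

text \<open>
  Write \<open>L\<close> for the graph Laplacian. If \<open>(a i, b i)\<close> is the part of a vector that belongs to the
  vertex \<open>i\<close>, then \<open>Lout\<close> maps it to the rotation by \<open>\<theta> i\<close> of the pair \<open>(L a i, L b i)\<close>. All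
  rotations are diagonal in the basis \<open>(1, \<i>)\<close>, \<open>(1, -\<i>)\<close>, so for an eigenvector at least one of
  \<open>x = a + \<i> b\<close> and \<open>x = a - \<i> b\<close> is nonzero and satisfies \<open>exp (\<i> \<phi> i) * L x i = z * x i\<close>
  at every vertex, with \<open>\<phi> = \<theta>\<close> or \<open>\<phi> = - \<theta>\<close> (\<open>Lout_eigenvalue_imp_rotated_eigen\<close>).

  Two facts are read off from this scalar equation. At a vertex where \<open>x\<close> is largest in modulus it
  yields a Gershgorin disc, which is one of the two discs that make up \<open>Rc_node\<close>
  (\<open>rotated_eigen_Gershgorin\<close>). Dividing by the phase and pairing with \<open>x\<close> yields
  \<open>z * s = q\<close>, where \<open>q = \<langle>x, L x\<rangle>\<close> is the nonnegative Dirichlet energy and \<open>s\<close> is the sum of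
  \<open>exp (- \<i> \<phi> i) * \<bar>x i\<bar>\<^sup>2\<close>. If \<open>z \<noteq> 0\<close> then \<open>q > 0\<close>, so \<open>z\<close> is a positive multiple of
  the conjugate of \<open>s\<close>, and the real part of \<open>z\<close> has the sign of the sum of
  \<open>cos (\<theta> i) * \<bar>x i\<bar>\<^sup>2\<close> (\<open>rotated_eigen_sign\<close>). This settles the location of the spectrum in
  all three cases.

  When the cosines all have the same strict sign, the zero eigenvalue has algebraic multiplicity
  exactly 2 because its generalised eigenspace consists of the vectors that carry the same pair at every vertex. Such vectors lie in the kernel.
  Conversely, suppose that \<open>Lout\<close> maps \<open>w\<close> to the vector that carries \<open>c\<close> everywhere. Rotating
  back gives \<open>L\<close> applied to \<open>w\<close> as \<open>c\<close> rotated by \<open>- \<theta> i\<close>, and \<open>L\<close> sums to zero over the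
  vertices. The sum of the rotations is itself a scaled rotation, with determinant \<open>C\<^sup>2 + S\<^sup>2\<close>
  for the sums \<open>C\<close> of the cosines and \<open>S\<close> of the sines, and \<open>C \<noteq> 0\<close>; hence \<open>c = 0\<close>, and \<open>w\<close>
  is constant because the graph is connected. The criterion \<open>order_char_poly_eq_kernel_dim\<close> turns
  this into the multiplicity of the root of the characteristic polynomial.
\<close>

section \<open>Multiplicity of the zero eigenvalue\<close>

lemma char_poly_four_block_lower_left_zero:
  fixes A :: "'a :: idom mat"
  assumes A: "A \<in> carrier_mat k k" and B: "B \<in> carrier_mat k m" and D: "D \<in> carrier_mat m m"
  shows "char_poly (four_block_mat A B (0\<^sub>m m k) D) = char_poly A * char_poly D"
proof -
  have "char_poly_matrix (four_block_mat A B (0\<^sub>m m k) D) =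
      four_block_mat (char_poly_matrix A) (map_mat (\<lambda>a. [:- a:]) B) (0\<^sub>m m k) (char_poly_matrix D)"
    using A B D by (intro eq_matI) (auto simp: char_poly_matrix_def)
  then show ?thesis
    unfolding char_poly_def
    using A B D by (simp add: det_four_block_mat_lower_left_zero[of _ k _ m])
qed

lemma char_poly_zero_mat: "char_poly (0\<^sub>m k k :: 'a :: comm_ring_1 mat) = monom 1 k"
proof -
  have "char_poly (0\<^sub>m k k :: 'a mat) = (\<Prod>a\<leftarrow>diag_mat (0\<^sub>m k k :: 'a mat). [:- a, 1:])"
    by (rule char_poly_upper_triangular[of _ k]) auto
  also have "diag_mat (0\<^sub>m k k :: 'a mat) = replicate k 0"
    by (rule nth_equalityI) (auto simp: diag_mat_def)
  finally show ?thesis by (simp add: monom_altdef)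
qed

text \<open>
  The columns of the matrix \<open>K\<close> with blocks \<open>1\<close> and \<open>X\<close>, one above the other, span \<open>k\<close>
  dimensions of the kernel of \<open>A\<close>. The second condition says that a vector which \<open>A\<close> maps into
  the range of \<open>K\<close> already lies in that range; it is only required for vectors whose first \<open>k\<close>
  entries vanish, since every vector can be brought to this form by subtracting one in the range.
  Together the conditions exclude further kernel vectors and Jordan blocks of size above 1. The
  change of basis whose first \<open>k\<close> new basis vectors are the columns of \<open>K\<close> makes \<open>A\<close> block upper
  triangular, with a zero block of size \<open>k\<close> and a nonsingular block on the diagonal.
\<close>

lemma order_char_poly_eq_kernel_dim:
  fixes A :: "'a :: field mat"
  assumes A: "A \<in> carrier_mat (k + m) (k + m)" and X: "X \<in> carrier_mat m k"
    and kernel: "\<And>c. c \<in> carrier_vec k \<Longrightarrow> A *\<^sub>v (c @\<^sub>v X *\<^sub>v c) = 0\<^sub>v (k + m)"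
    and semisimple: "\<And>y c. y \<in> carrier_vec m \<Longrightarrow> c \<in> carrier_vec k \<Longrightarrow>
      A *\<^sub>v (0\<^sub>v k @\<^sub>v y) = c @\<^sub>v X *\<^sub>v c \<Longrightarrow> y = 0\<^sub>v m"
  shows "order 0 (char_poly A) = k"
proof -
  obtain A1 A2 A3 A4 where split: "split_block A k k = (A1, A2, A3, A4)"
    by (metis prod_cases4)
  note blocks = split_block[OF split, of m m]
  have carr: "A1 \<in> carrier_mat k k" "A2 \<in> carrier_mat k m"
      "A3 \<in> carrier_mat m k" "A4 \<in> carrier_mat m m"
    and A_eq: "A = four_block_mat A1 A2 A3 A4"
    using blocks A by auto
  have mult: "A *\<^sub>v (c @\<^sub>v y) = (A1 *\<^sub>v c + A2 *\<^sub>v y) @\<^sub>v (A3 *\<^sub>v c + A4 *\<^sub>v y)"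
    if "c \<in> carrier_vec k" "y \<in> carrier_vec m" for c y
    unfolding A_eq using carr that by (intro four_block_mat_mult_vec)
  have eq0: "M = 0\<^sub>m r k" if M: "M \<in> carrier_mat r k"
    and z: "\<And>c. c \<in> carrier_vec k \<Longrightarrow> M *\<^sub>v c = 0\<^sub>v r" for M :: "'a mat" and r
  proof (rule eq_matI)
    fix i j assume "i < dim_row (0\<^sub>m r k :: 'a mat)" "j < dim_col (0\<^sub>m r k :: 'a mat)"
    then have ij: "i < r" "j < k" by auto
    have "(M *\<^sub>v unit_vec k j) $ i = M $$ (i, j)"
      using M ij by (simp add: mult_mat_vec_def)
    then show "M $$ (i, j) = 0\<^sub>m r k $$ (i, j)" using z[of "unit_vec k j"] ij by simp
  qed (use M in auto)
  have split0: "(0\<^sub>v (k + m) :: 'a vec) = 0\<^sub>v k @\<^sub>v 0\<^sub>v m" by auto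
  have z12: "A1 *\<^sub>v c + A2 *\<^sub>v (X *\<^sub>v c) = 0\<^sub>v k"
    and z34: "A3 *\<^sub>v c + A4 *\<^sub>v (X *\<^sub>v c) = 0\<^sub>v m" if c: "c \<in> carrier_vec k" for c
  proof -
    have "(A1 *\<^sub>v c + A2 *\<^sub>v (X *\<^sub>v c)) @\<^sub>v (A3 *\<^sub>v c + A4 *\<^sub>v (X *\<^sub>v c)) = 0\<^sub>v k @\<^sub>v 0\<^sub>v m"
      using kernel[OF c] mult[OF c, of "X *\<^sub>v c"] X c split0 by simp
    then show "A1 *\<^sub>v c + A2 *\<^sub>v (X *\<^sub>v c) = 0\<^sub>v k" "A3 *\<^sub>v c + A4 *\<^sub>v (X *\<^sub>v c) = 0\<^sub>v m"
      using carr X c by (subst (asm) append_vec_eq[of _ k]; auto)+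
  qed
  have b1: "A1 + A2 * X = 0\<^sub>m k k"
    by (rule eq0) (use carr X z12 in \<open>auto simp: add_mult_distrib_mat_vec[of _ k k] assoc_mult_mat_vec[of _ k m _ k]\<close>)
  have b3: "A3 + A4 * X = 0\<^sub>m m k"
    by (rule eq0) (use carr X z34 in \<open>auto simp: add_mult_distrib_mat_vec[of _ m k] assoc_mult_mat_vec[of _ m m _ k]\<close>)
  \<comment> \<open>The columns of \<open>P\<close> are the new basis, and \<open>Q\<close> is the inverse of \<open>P\<close>.\<close>
  define P where "P = four_block_mat (1\<^sub>m k) (0\<^sub>m k m) X (1\<^sub>m m)"
  define Q where "Q = four_block_mat (1\<^sub>m k) (0\<^sub>m k m) (- X) (1\<^sub>m m)"
  define M where "M = A4 - X * A2"
  define B where "B = four_block_mat (0\<^sub>m k k) A2 (0\<^sub>m m k) M"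
  have M: "M \<in> carrier_mat m m" using carr X by (auto simp: M_def)
  have PQc: "P \<in> carrier_mat (k + m) (k + m)" "Q \<in> carrier_mat (k + m) (k + m)"
    "B \<in> carrier_mat (k + m) (k + m)"
    using X carr M by (auto simp: P_def Q_def B_def)
  have QP: "Q * P = 1\<^sub>m (k + m)"
    unfolding P_def Q_def using X
    by (subst mult_four_block_mat[of _ k k _ m _ m _ _ k _ m]) (auto simp: uminus_l_inv_mat[of _ m k])
  have PQ: "P * Q = 1\<^sub>m (k + m)"
    using mat_mult_left_right_inverse[OF PQc(2,1) QP] .
  have AP: "A * P = four_block_mat (0\<^sub>m k k) A2 (0\<^sub>m m k) A4"
    unfolding P_def A_eq using X carr
    by (subst mult_four_block_mat[of _ k k _ m _ m _ _ k _ m]) (auto simp: b1 b3)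
  have PB: "P * B = four_block_mat (0\<^sub>m k k) A2 (0\<^sub>m m k) A4"
  proof -
    have "X * A2 + M = A4"
      using carr X by (intro eq_matI) (auto simp: M_def)
    then show ?thesis
      unfolding P_def B_def using X carr M
      by (subst mult_four_block_mat[of _ k k _ m _ m _ _ k _ m]) auto
  qed
  have "A = P * B * Q"
    using AP PB PQ A PQc by (metis assoc_mult_mat right_mult_one_mat)
  then have "similar_mat A B"
    using PQ QP A PQc by (intro similar_matI[of _ _ P Q "k + m"]) auto
  then have cp: "char_poly A = monom 1 k * char_poly M"
    using carr M
    by (simp add: char_poly_similar B_def char_poly_zero_mat char_poly_four_block_lower_left_zero)
  have "\<not> eigenvalue M 0"
  proof
    assume "eigenvalue M 0"
    then obtain y where y: "y \<in> carrier_vec m" "y \<noteq> 0\<^sub>v m" "M *\<^sub>v y = 0 \<cdot>\<^sub>v y"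
      using M by (auto simp: eigenvalue_def eigenvector_def)
    have My: "M *\<^sub>v y = 0\<^sub>v m"
      unfolding y(3) using y(1) by (intro eq_vecI) auto
    define c where "c = A2 *\<^sub>v y"
    have c: "c \<in> carrier_vec k" using carr y by (auto simp: c_def)
    have diff: "A4 *\<^sub>v y - X *\<^sub>v c = 0\<^sub>v m"
      using My y(1) carr X by (simp add: M_def c_def minus_mult_distrib_mat_vec[of _ m m] assoc_mult_mat_vec[of _ m k _ m])
    have mult0: "N *\<^sub>v 0\<^sub>v k = 0\<^sub>v r" if "N \<in> carrier_mat r k" for N :: "'a mat" and r
      using that by (intro eq_vecI) auto
    have "A4 *\<^sub>v y = X *\<^sub>v c"
      using diff carr X y(1) c by (auto simp: vec_eq_iff)
    then have "A *\<^sub>v (0\<^sub>v k @\<^sub>v y) = c @\<^sub>v X *\<^sub>v c"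
      using mult[of "0\<^sub>v k" y] y(1) carr X c mult0[OF carr(1)] mult0[OF carr(3)]
      by (simp add: c_def)
    with semisimple y c show False by blast
  qed
  then have "poly (char_poly M) 0 \<noteq> 0" using eigenvalue_root_char_poly[OF M] by blast
  moreover from this have "char_poly M \<noteq> 0" by auto
  ultimately show ?thesis
    by (simp add: cp order_mult order_0I order_0_monom)
qed

section \<open>The Laplacian\<close>

definition lap :: "'a pair_pre_digraph \<Rightarrow> ('a \<Rightarrow> complex) \<Rightarrow> 'a \<Rightarrow> complex" where
  "lap G x i = (\<Sum>j\<in>nbrs G i. x i - x j)"

definition energy :: "'a pair_pre_digraph \<Rightarrow> ('a \<Rightarrow> complex) \<Rightarrow> real" where
  "energy G x = (\<Sum>(i, j)\<in>parcs G. (cmod (x i - x j))\<^sup>2) / 2"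

lemma lap_eq: "finite (nbrs G i) \<Longrightarrow> lap G x i = of_real (num_nbrs G i) * x i - (\<Sum>j\<in>nbrs G i. x j)"
  by (simp add: lap_def num_nbrs_def sum_subtractf)

lemma lap_add: "lap G (\<lambda>i. x i + c * y i) i = lap G x i + c * lap G y i"
  by (simp add: lap_def sum.distrib[symmetric] sum_distrib_left algebra_simps)

context pair_graph
begin

lemma finite_nbrs: "finite (nbrs G i)"
  using pair_finite_verts by (simp add: nbrs_def)

lemma arc_sym: "(i, j) \<in> parcs G \<Longrightarrow> (j, i) \<in> parcs G"
  using pair_sym_arcs by (auto simp: symmetric_def elim: symE)

text \<open>
  Sums over vertices and neighbours become sums over arcs, where the symmetry of the graph is the
  invariance under reversing arcs. Both the vanishing total of the Laplacian and the formula for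
  the energy come from averaging a sum over arcs with its reversal.
\<close>

lemma sum_nbrs_eq_sum_arcs:
  "(\<Sum>i\<in>pverts G. \<Sum>j\<in>nbrs G i. f i j) = (\<Sum>(i, j)\<in>parcs G. f i j)"
proof -
  have "Sigma (pverts G) (nbrs G) = parcs G"
    by (auto simp: nbrs_def dest: in_arcsD1 in_arcsD2)
  then show ?thesis
    using sum.Sigma[of "pverts G" "nbrs G" f] pair_finite_verts finite_nbrs by auto
qed

lemma sum_arcs_swap: "(\<Sum>(i, j)\<in>parcs G. f i j) = (\<Sum>(i, j)\<in>parcs G. f j i)"
  by (rule sum.reindex_bij_witness[of _ prod.swap prod.swap]) (auto dest: arc_sym)

lemma sum_lap_eq_0: "(\<Sum>i\<in>pverts G. lap G x i) = 0"
proof -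
  let ?s = "\<Sum>(i, j)\<in>parcs G. x i - x j"
  have "?s = (\<Sum>(i, j)\<in>parcs G. x j - x i)" by (rule sum_arcs_swap)
  also have "\<dots> = - ?s" by (simp add: sum_negf[symmetric] case_prod_unfold)
  finally have "?s = 0" by simp
  then show ?thesis by (simp add: lap_def sum_nbrs_eq_sum_arcs)
qed

lemma sum_cnj_lap: "(\<Sum>i\<in>pverts G. cnj (x i) * lap G x i) = of_real (energy G x)"
proof -
  let ?s = "\<lambda>f. \<Sum>(i, j)\<in>parcs G. f i j"
  let ?a = "\<lambda>i j. cnj (x i) * (x i - x j)"
  have "2 * ?s ?a = ?s ?a + ?s (\<lambda>i j. ?a j i)"
    using sum_arcs_swap[of ?a] by simp
  also have "\<dots> = ?s (\<lambda>i j. of_real ((cmod (x i - x j))\<^sup>2))"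
    unfolding sum.distrib[symmetric] case_prod_unfold
    by (intro sum.cong refl) (simp add: complex_norm_square algebra_simps flip: of_real_power)
  also have "\<dots> = of_real (2 * energy G x)"
    by (simp add: energy_def case_prod_unfold)
  finally have "2 * ?s ?a = 2 * of_real (energy G x)" by simp
  then have "?s ?a = of_real (energy G x)" by (simp only: mult_cancel_left) simp
  then show ?thesis
    by (simp only: lap_def sum_distrib_left sum_nbrs_eq_sum_arcs)
qed

lemma energy_nonneg: "0 \<le> energy G x"
  by (auto simp: energy_def intro!: sum_nonneg)

lemma energy_eq_0_imp_eq_on_arcs:
  assumes "energy G x = 0" "(i, j) \<in> parcs G"
  shows "x i = x j"
proof -
  have "(\<Sum>(i, j)\<in>parcs G. (cmod (x i - x j))\<^sup>2) = 0"
    using assms by (simp add: energy_def)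
  then have "\<forall>p\<in>parcs G. (case p of (i, j) \<Rightarrow> (cmod (x i - x j))\<^sup>2) = 0"
    using pair_finite_arcs by (subst (asm) sum_nonneg_eq_0_iff) auto
  with assms(2) show ?thesis by auto
qed

lemma energy_eq_0_imp_lap_eq_0: "energy G x = 0 \<Longrightarrow> lap G x i = 0"
  by (auto simp: lap_def nbrs_def intro!: sum.neutral dest: energy_eq_0_imp_eq_on_arcs)

text \<open>
  A harmonic function has zero energy, so it takes equal values at the ends of every arc and hence
  along every path.
\<close>

lemma lap_eq_0_imp_constant:
  assumes conn: "Digraph_Component.connected (with_proj G)"
    and lap0: "\<And>i. i \<in> pverts G \<Longrightarrow> lap G x i = 0"
    and uv: "u \<in> pverts G" "v \<in> pverts G"
  shows "x u = x v"
proof -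
  have "energy G x = 0" using sum_cnj_lap[of x] lap0 by simp
  have "reachable (with_proj (mk_symmetric (with_proj G))) u v"
    using conn uv by (auto simp: Digraph_Component.connected_def strongly_connected_def)
  then have "reachable (with_proj G) u v"
    using reachable_mk_symmetric_eq[OF pair_sym_arcs] by simp
  then show ?thesis
    by (induction rule: reachable_induct)
      (auto dest: energy_eq_0_imp_eq_on_arcs[OF \<open>energy G x = 0\<close>])
qed

section \<open>The rotated Laplacian\<close>

text \<open>
  The phase is moved to the other side before pairing with \<open>x\<close>, so that the pairing gives the
  Hermitian form of the unrotated Laplacian, which is real.
\<close>

lemma rotated_eigen_energy:
  assumes "\<And>i. i \<in> pverts G \<Longrightarrow> cis (\<phi> i) * lap G x i = z * x i"
  shows "z * (\<Sum>i\<in>pverts G. cis (- \<phi> i) * of_real ((cmod (x i))\<^sup>2)) = of_real (energy G x)"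
proof -
  have "lap G x i = z * cis (- \<phi> i) * x i" if "i \<in> pverts G" for i
  proof -
    have "lap G x i = cis (- \<phi> i) * (cis (\<phi> i) * lap G x i)"
      by (simp add: cis_mult flip: mult.assoc)
    also have "\<dots> = z * cis (- \<phi> i) * x i" by (simp only: assms[OF that] ac_simps)
    finally show ?thesis .
  qed
  then have "of_real (energy G x) = (\<Sum>i\<in>pverts G. cnj (x i) * (z * cis (- \<phi> i) * x i))"
    by (simp flip: sum_cnj_lap)
  also have "\<dots> = z * (\<Sum>i\<in>pverts G. cis (- \<phi> i) * of_real ((cmod (x i))\<^sup>2))"
    unfolding sum_distrib_left
    by (intro sum.cong refl) (simp add: complex_norm_square algebra_simps flip: of_real_power)
  finally show ?thesis by simp
qed

text \<open>
  The energy is positive since zero energy forces \<open>lap G x\<close> to vanish, and then \<open>z * x v = 0\<close>.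
  The identity is the real part of the preceding lemma multiplied by the conjugate of \<open>z\<close>. Only
  the cosine of \<open>\<phi>\<close> enters, so it does not matter whether \<open>\<phi>\<close> is \<open>\<theta>\<close> or \<open>- \<theta>\<close>.
\<close>

lemma rotated_eigen_sign:
  assumes eigen: "\<And>i. i \<in> pverts G \<Longrightarrow> cis (\<phi> i) * lap G x i = z * x i"
    and v: "v \<in> pverts G" "x v \<noteq> 0" and "z \<noteq> 0"
  shows "energy G x > 0"
    and "(cmod z)\<^sup>2 * (\<Sum>i\<in>pverts G. cos (\<phi> i) * (cmod (x i))\<^sup>2) = energy G x * Re z"
proof -
  define s where "s = (\<Sum>i\<in>pverts G. cis (- \<phi> i) * of_real ((cmod (x i))\<^sup>2))"
  have zs: "z * s = of_real (energy G x)"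
    unfolding s_def by (rule rotated_eigen_energy) (rule eigen)
  have "energy G x \<noteq> 0"
    using energy_eq_0_imp_lap_eq_0[of x v] eigen[OF v(1)] v(2) \<open>z \<noteq> 0\<close> by auto
  then have pos: "energy G x > 0" using energy_nonneg[of x] by simp
  have "of_real ((cmod z)\<^sup>2) * s = cnj z * (z * s)"
    by (simp only: complex_norm_square ac_simps)
  also have "\<dots> = cnj z * of_real (energy G x)" by (simp only: zs)
  finally have "Re (of_real ((cmod z)\<^sup>2) * s) = Re (cnj z * of_real (energy G x))" by simp
  then have "(cmod z)\<^sup>2 * Re s = energy G x * Re z" by simp
  moreover have "Re s = (\<Sum>i\<in>pverts G. cos (\<phi> i) * (cmod (x i))\<^sup>2)"
    by (simp add: s_def)
  ultimately show "(cmod z)\<^sup>2 * (\<Sum>i\<in>pverts G. cos (\<phi> i) * (cmod (x i))\<^sup>2) = energy G x * Re z"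
    by simp
  show "energy G x > 0" by (rule pos)
qed

text \<open>
  Gershgorin's argument: at a vertex where \<open>x\<close> has the largest modulus, the row of the equation
  bounds the distance of \<open>z\<close> to the diagonal entry by the number of neighbours.
\<close>

lemma rotated_eigen_Gershgorin:
  assumes eigen: "\<And>i. i \<in> pverts G \<Longrightarrow> cis (\<phi> i) * lap G x i = z * x i"
    and v: "v \<in> pverts G" "x v \<noteq> 0"
  shows "\<exists>i\<in>pverts G. cmod (z - of_real (num_nbrs G i) * cis (\<phi> i)) \<le> num_nbrs G i"
proof -
  obtain i where i: "i \<in> pverts G" and max: "\<And>j. j \<in> pverts G \<Longrightarrow> cmod (x j) \<le> cmod (x i)"
  proof -
    have "Max ((\<lambda>j. cmod (x j)) ` pverts G) \<in> (\<lambda>j. cmod (x j)) ` pverts G"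
      using v pair_finite_verts by (intro Max_in) auto
    then obtain i where "i \<in> pverts G" "Max ((\<lambda>j. cmod (x j)) ` pverts G) = cmod (x i)" by auto
    then show ?thesis
      using that[of i] pair_finite_verts by (metis Max_ge finite_imageI imageI)
  qed
  have pos: "cmod (x i) > 0" using max[OF v(1)] v(2) by (metis norm_le_zero_iff not_le order_trans)
  have "(z - of_real (num_nbrs G i) * cis (\<phi> i)) * x i = - cis (\<phi> i) * (\<Sum>j\<in>nbrs G i. x j)"
    using eigen[OF i] by (simp add: lap_eq[OF finite_nbrs] algebra_simps)
  then have "cmod (z - of_real (num_nbrs G i) * cis (\<phi> i)) * cmod (x i) = cmod (\<Sum>j\<in>nbrs G i. x j)"
    by (metis norm_cis norm_minus_cancel norm_mult mult_1)
  also have "\<dots> \<le> num_nbrs G i * cmod (x i)"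
    unfolding num_nbrs_def
    by (rule order_trans[OF norm_sum]) (auto intro!: sum_bounded_above max simp: nbrs_def)
  finally show ?thesis using pos i by auto
qed

lemma rotated_Gershgorin_disc_subset_Rc:
  assumes "i \<in> pverts G" "\<phi> i = \<theta> i \<or> \<phi> i = - \<theta> i"
    and "cmod (z - of_real (num_nbrs G i) * cis (\<phi> i)) \<le> num_nbrs G i"
  shows "z \<in> Rc G \<theta>"
proof -
  have "(cmod (z - of_real (num_nbrs G i) * cis (\<phi> i)))\<^sup>2 \<le> (num_nbrs G i)\<^sup>2"
    using assms(3) by (intro power_mono) auto
  then show ?thesis
    using assms(1,2) by (auto simp: Rc_def Rc_node_def cmod_power2)
qed

lemma sum_laplacian_row:
  assumes "i \<in> pverts G"
  shows "(\<Sum>j\<in>pverts G. of_real (if i = j then \<Sum>k\<in>nbrs G i. wt G i k else - wt G i j) * x j)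
    = lap G x i"
proof -
  have "i \<notin> nbrs G i" using pair_no_loops[of "(i, i)"] by (auto simp: nbrs_def)
  then have "(\<Sum>j\<in>pverts G. of_real (if i = j then \<Sum>k\<in>nbrs G i. wt G i k else - wt G i j) * x j)
    = (\<Sum>j\<in>pverts G. (if i = j then of_real (num_nbrs G i) * x j else 0)
        - (if j \<in> nbrs G i then x j else 0))"
    by (intro sum.cong refl) (auto simp: wt_def num_nbrs_def)
  also have "\<dots> = of_real (num_nbrs G i) * x i - (\<Sum>j\<in>nbrs G i. x j)"
  proof -
    have "pverts G \<inter> nbrs G i = nbrs G i" by (auto simp: nbrs_def)
    then show ?thesis
      using assms pair_finite_verts
      by (simp add: sum_subtractf sum.delta sum.inter_restrict[symmetric])
  qed
  finally show ?thesis by (simp add: lap_eq[OF finite_nbrs])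
qed

end

section \<open>The matrix acting on pairs of vertex functions\<close>

text \<open>
  A vector of length \<open>2 * n\<close> interleaves two functions on the vertices \<open>1, \<dots>, n\<close>; \<open>coord a v\<close>
  extracts the one at offset \<open>a\<close>, which is 0 or 1.
\<close>

definition coord :: "nat \<Rightarrow> complex vec \<Rightarrow> nat \<Rightarrow> complex" where
  "coord a v i = v $ (2 * (i - 1) + a)"

lemma Lout_complex_carrier [simp]: "Lout_complex n G \<theta> \<in> carrier_mat (2 * n) (2 * n)"
  by (simp add: Lout_complex_def Lout_def)

lemma vec_eq_0_if_coords_eq_0:
  assumes "v \<in> carrier_vec (2 * n)"
    and "\<And>i. i \<in> {1..n} \<Longrightarrow> coord 0 v i = 0 \<and> coord 1 v i = 0"
  shows "v = 0\<^sub>v (2 * n)"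
proof (rule eq_vecI)
  fix r assume "r < dim_vec (0\<^sub>v (2 * n) :: complex vec)"
  then have r: "r < 2 * n" by simp
  then have "r div 2 + 1 \<in> {1..n}" by auto
  from assms(2)[OF this] have "v $ (2 * (r div 2)) = 0" "v $ (2 * (r div 2) + 1) = 0"
    by (auto simp: coord_def)
  then have "v $ r = 0"
    by (cases "even r") (metis dvd_mult_div_cancel, metis odd_two_times_div_two_succ)
  then show "v $ r = 0\<^sub>v (2 * n) $ r" using r by simp
qed (use assms in auto)

lemma sum_pairs: "(\<Sum>r<2 * n. f r) = (\<Sum>i\<in>{1..n}. f (2 * (i - 1)) + f (2 * (i - 1) + 1))"
  for f :: "nat \<Rightarrow> 'a :: comm_monoid_add"
  by (induction n) (auto simp: ac_simps)

lemma coord_Lout_complex_mult: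
  assumes G: "pair_graph G" and V: "pverts G = {1..n}"
    and v: "v \<in> carrier_vec (2 * n)" and i: "i \<in> {1..n}"
  shows "coord 0 (Lout_complex n G \<theta> *\<^sub>v v) i =
      of_real (cos (\<theta> i)) * lap G (coord 0 v) i - of_real (sin (\<theta> i)) * lap G (coord 1 v) i" (is ?A)
    and "coord 1 (Lout_complex n G \<theta> *\<^sub>v v) i =
      of_real (sin (\<theta> i)) * lap G (coord 0 v) i + of_real (cos (\<theta> i)) * lap G (coord 1 v) i" (is ?B)
proof -
  interpret pair_graph G by fact
  let ?l = "\<lambda>j. if i = j then \<Sum>k\<in>nbrs G i. wt G i k else - wt G i j"
  have block: "Lout_block G \<theta> i j = ?l j \<cdot>\<^sub>m rot (\<theta> i)" for j
    by (simp add: Lout_block_def)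
  have rot_carrier: "rot t \<in> carrier_mat 2 2" for t by (simp add: rot_def mat_of_rows_list_def numeral_2_eq_2)
  have row: "coord a (Lout_complex n G \<theta> *\<^sub>v v) i =
      of_real (rot (\<theta> i) $$ (a, 0)) * lap G (coord 0 v) i + of_real (rot (\<theta> i) $$ (a, 1)) * lap G (coord 1 v) i"
    if a: "a < 2" for a
  proof -
    let ?r = "2 * (i - 1) + a"
    have r: "?r < 2 * n" "?r div 2 + 1 = i" "?r mod 2 = a" using a i by auto
    have entry: "Lout_complex n G \<theta> $$ (?r, 2 * (j - 1) + b) =
        of_real (?l j) * of_real (rot (\<theta> i) $$ (a, b))" if "j \<in> {1..n}" "b < 2" for j b
    proof -
      have c: "2 * (j - 1) + b < 2 * n" "(2 * (j - 1) + b) div 2 + 1 = j" "(2 * (j - 1) + b) mod 2 = b"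
        using that by auto
      show ?thesis
        unfolding Lout_complex_def Lout_def using r c a that rot_carrier[of "\<theta> i"]
        by (simp only: index_map_mat index_mat prod.case block dim_row_mat dim_col_mat) simp
    qed
    have "coord a (Lout_complex n G \<theta> *\<^sub>v v) i = (\<Sum>c<2 * n. Lout_complex n G \<theta> $$ (?r, c) * v $ c)"
      using r v carrier_matD[OF Lout_complex_carrier[of n G \<theta>]]
      by (simp add: coord_def scalar_prod_def atLeast0LessThan)
    also have "\<dots> = (\<Sum>j\<in>{1..n}. of_real (rot (\<theta> i) $$ (a, 0)) * (of_real (?l j) * coord 0 v j)
        + of_real (rot (\<theta> i) $$ (a, 1)) * (of_real (?l j) * coord 1 v j))"
      unfolding sum_pairs
    proof (rule sum.cong[OF refl])
      fix j assume "j \<in> {1..n}"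
      from entry[OF this, of 0] entry[OF this, of 1]
      show "Lout_complex n G \<theta> $$ (?r, 2 * (j - 1)) * v $ (2 * (j - 1)) +
          Lout_complex n G \<theta> $$ (?r, 2 * (j - 1) + 1) * v $ (2 * (j - 1) + 1) =
        of_real (rot (\<theta> i) $$ (a, 0)) * (of_real (?l j) * coord 0 v j)
        + of_real (rot (\<theta> i) $$ (a, 1)) * (of_real (?l j) * coord 1 v j)"
        by (simp add: coord_def ac_simps del: of_real_eq_iff)
    qed
    also have "\<dots> = of_real (rot (\<theta> i) $$ (a, 0)) * lap G (coord 0 v) i
        + of_real (rot (\<theta> i) $$ (a, 1)) * lap G (coord 1 v) i"
      unfolding sum.distrib sum_distrib_left[symmetric]
      using sum_laplacian_row[of i] i V by simp
    finally show ?thesis .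
  qed
  from row[of 0] row[of 1] show ?A ?B by (simp_all add: rot_def mat_of_rows_list_def)
qed

text \<open>
  The two combinations \<open>a + \<epsilon> * \<i> * b\<close> of the coordinate functions, for \<open>\<epsilon> = 1\<close> and
  \<open>\<epsilon> = -1\<close>, diagonalise all rotations at once and determine \<open>a\<close> and \<open>b\<close>, so one of them is
  nonzero.
\<close>

lemma Lout_eigenvalue_imp_rotated_eigen:
  assumes G: "pair_graph G" and V: "pverts G = {1..n}"
    and ev: "eigenvalue (Lout_complex n G \<theta>) z"
  obtains x \<phi> v where "\<phi> = \<theta> \<or> \<phi> = (\<lambda>i. - \<theta> i)"
    "\<And>i. i \<in> pverts G \<Longrightarrow> cis (\<phi> i) * lap G x i = z * x i" "v \<in> pverts G" "x v \<noteq> 0"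
proof -
  let ?A = "Lout_complex n G \<theta>"
  obtain w where w: "w \<in> carrier_vec (2 * n)" "w \<noteq> 0\<^sub>v (2 * n)" "?A *\<^sub>v w = z \<cdot>\<^sub>v w"
    using ev Lout_complex_carrier[of n G \<theta>] unfolding eigenvalue_def eigenvector_def by auto
  let ?x = "\<lambda>\<epsilon> i. coord 0 w i + \<epsilon> * \<i> * coord 1 w i"
  have coord_smult: "coord a (z \<cdot>\<^sub>v w) i = z * coord a w i" if "i \<in> {1..n}" "a < 2" for a i
    using that w by (auto simp: coord_def)
  have rot0: "of_real (cos (\<theta> i)) * lap G (coord 0 w) i - of_real (sin (\<theta> i)) * lap G (coord 1 w) i
      = z * coord 0 w i"
    and rot1: "of_real (sin (\<theta> i)) * lap G (coord 0 w) i + of_real (cos (\<theta> i)) * lap G (coord 1 w) i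
      = z * coord 1 w i"
    if "i \<in> {1..n}" for i
    using coord_Lout_complex_mult[OF G V w(1) that, of \<theta>] coord_smult[OF that] w(3) by simp_all
  have eigen: "(of_real (cos (\<theta> i)) + \<epsilon> * \<i> * of_real (sin (\<theta> i))) * lap G (?x \<epsilon>) i = z * ?x \<epsilon> i"
    if "\<epsilon> = 1 \<or> \<epsilon> = - 1" "i \<in> {1..n}" for \<epsilon> i
  proof -
    have "z * ?x \<epsilon> i = z * coord 0 w i + \<epsilon> * \<i> * (z * coord 1 w i)" by (simp add: algebra_simps)
    then show ?thesis
      unfolding lap_add rot0[OF that(2), symmetric] rot1[OF that(2), symmetric]
      using that(1) by (auto simp: algebra_simps)
  qed
  obtain i where i: "i \<in> {1..n}" "coord 0 w i \<noteq> 0 \<or> coord 1 w i \<noteq> 0"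
    using vec_eq_0_if_coords_eq_0[OF w(1)] w(2) by blast
  have "?x 1 i \<noteq> 0 \<or> ?x (-1) i \<noteq> 0"
  proof (rule ccontr)
    assume "\<not> ?thesis"
    then have p: "?x 1 i = 0" and m: "?x (-1) i = 0" by auto
    have "2 * coord 0 w i = ?x 1 i + ?x (-1) i" "2 * \<i> * coord 1 w i = ?x 1 i - ?x (-1) i"
      by (simp_all add: algebra_simps)
    with i(2) p m show False by simp
  qed
  then obtain \<epsilon> :: complex where \<epsilon>: "\<epsilon> = 1 \<or> \<epsilon> = - 1" "?x \<epsilon> i \<noteq> 0" by blast
  define \<phi> where "\<phi> = (if \<epsilon> = 1 then \<theta> else (\<lambda>i. - \<theta> i))"
  have cis_\<phi>: "cis (\<phi> j) = of_real (cos (\<theta> j)) + \<epsilon> * \<i> * of_real (sin (\<theta> j))" for j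
    using \<epsilon>(1) by (auto simp: \<phi>_def complex_eq_iff)
  show ?thesis
  proof (rule that[of \<phi> "?x \<epsilon>" i])
    show "cis (\<phi> j) * lap G (?x \<epsilon>) j = z * ?x \<epsilon> j" if "j \<in> pverts G" for j
      unfolding cis_\<phi> using eigen[OF \<epsilon>(1)] that V by blast
  qed (use \<epsilon>(2) i V in \<open>auto simp: \<phi>_def\<close>)
qed

text \<open>
  Both signs of the cosines are covered, since all that matters is that the cosines do not sum to
  zero: this makes the sum of the inverse rotations invertible.
\<close>

lemma order_0_char_poly_Lout:
  assumes G: "pair_graph G" and V: "pverts G = {1..n}"
    and conn: "Digraph_Component.connected (with_proj G)"
    and C: "(\<Sum>i\<in>pverts G. cos (\<theta> i)) \<noteq> 0"
  shows "order 0 (char_poly (Lout_complex n G \<theta>)) = 2"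
proof -
  interpret pair_graph G by fact
  let ?A = "Lout_complex n G \<theta>"
  have n: "n \<ge> 1" using C V by (cases n) auto
  define m where "m = 2 * n - 2"
  have nm: "2 * n = 2 + m" using n by (simp add: m_def)
  \<comment> \<open>\<open>X\<close> repeats a pair at the vertices \<open>2, \<dots>, n\<close>, so \<open>c @\<^sub>v X *\<^sub>v c\<close> carries \<open>c\<close> at every vertex.\<close>
  define X :: "complex mat" where "X = mat m 2 (\<lambda>(r, c). if r mod 2 = c then 1 else 0)"
  have X: "X \<in> carrier_mat m 2" by (simp add: X_def)
  have rep: "coord a (c @\<^sub>v X *\<^sub>v c) i = c $ a" if c: "c \<in> carrier_vec 2" and "a < 2" "i \<in> {1..n}" for c a i
  proof -
    have Xc: "(X *\<^sub>v c) $ r = c $ (r mod 2)" if "r < m" for r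
    proof -
      have "(X *\<^sub>v c) $ r = (\<Sum>b\<in>{0..<2}. (if r mod 2 = b then 1 else 0) * c $ b)"
        using that c by (simp add: X_def scalar_prod_def)
      also have "\<dots> = c $ (r mod 2)" by (simp add: if_distrib[of "\<lambda>t. t * _"] sum.delta cong: if_cong)
      finally show ?thesis .
    qed
    show ?thesis
    proof (cases "i = 1")
      case True
      then show ?thesis using that X by (simp add: coord_def)
    next
      case False
      define r where "r = 2 * (i - 2) + a"
      have r: "2 * (i - 1) + a = 2 + r" "r < m" "r mod 2 = a"
        using False that nm by (auto simp: r_def)
      have "(c @\<^sub>v X *\<^sub>v c) $ (2 + r) = (X *\<^sub>v c) $ r"
        using c X r(2) by simp
      then show ?thesis unfolding coord_def r(1) Xc[OF r(2)] r(3) .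
    qed
  qed
  show ?thesis
  proof (rule order_char_poly_eq_kernel_dim[OF _ X])
    show "?A \<in> carrier_mat (2 + m) (2 + m)" using Lout_complex_carrier[of n G \<theta>] nm by simp
  next
    fix c :: "complex vec" assume c: "c \<in> carrier_vec 2"
    have cX: "c @\<^sub>v X *\<^sub>v c \<in> carrier_vec (2 * n)"
      unfolding nm using c X by (intro append_carrier_vec) auto
    have lap0: "lap G (coord a (c @\<^sub>v X *\<^sub>v c)) i = 0" if "a < 2" "i \<in> {1..n}" for a i
      unfolding lap_def using rep[OF c] that V by (intro sum.neutral) (auto simp: nbrs_def)
    show "?A *\<^sub>v (c @\<^sub>v X *\<^sub>v c) = 0\<^sub>v (2 + m)"
      unfolding nm[symmetric]
    proof (rule vec_eq_0_if_coords_eq_0)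
      show "?A *\<^sub>v (c @\<^sub>v X *\<^sub>v c) \<in> carrier_vec (2 * n)"
        using cX Lout_complex_carrier by (rule mult_mat_vec_carrier[rotated])
    qed (use coord_Lout_complex_mult[OF G V cX] lap0 in simp)
  next
    fix y c :: "complex vec"
    assume y: "y \<in> carrier_vec m" and c: "c \<in> carrier_vec 2"
      and eq: "?A *\<^sub>v (0\<^sub>v 2 @\<^sub>v y) = c @\<^sub>v X *\<^sub>v c"
    let ?w = "0\<^sub>v 2 @\<^sub>v y"
    have w: "?w \<in> carrier_vec (2 * n)"
      unfolding nm using y by (intro append_carrier_vec) auto
    define l0 l1 where "l0 = lap G (coord 0 ?w)" and "l1 = lap G (coord 1 ?w)"
    have e0: "of_real (cos (\<theta> i)) * l0 i - of_real (sin (\<theta> i)) * l1 i = c $ 0"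
      and e1: "of_real (sin (\<theta> i)) * l0 i + of_real (cos (\<theta> i)) * l1 i = c $ 1"
      if "i \<in> {1..n}" for i
      using coord_Lout_complex_mult[OF G V w that, of \<theta>] rep[OF c _ that]
      by (simp_all add: eq l0_def l1_def)
    have sc: "of_real (cos t) * of_real (cos t) + of_real (sin t) * of_real (sin t) = (1 :: complex)" for t
      by (metis of_real_1 of_real_add of_real_mult power2_eq_square sin_cos_squared_add add.commute)
    \<comment> \<open>Rotate back by \<open>- \<theta> i\<close>.\<close>
    have l0: "l0 i = of_real (cos (\<theta> i)) * c $ 0 + of_real (sin (\<theta> i)) * c $ 1"
      and l1: "l1 i = of_real (cos (\<theta> i)) * c $ 1 - of_real (sin (\<theta> i)) * c $ 0"
      if "i \<in> {1..n}" for i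
    proof -
      have rotate_back: "p = u * (u * p - v * q) + v * (v * p + u * q)"
          "q = u * (v * p + u * q) - v * (u * p - v * q)"
        if "u * u + v * v = 1" for u v p q :: complex
      proof -
        have "u * (u * p - v * q) + v * (v * p + u * q) = (u * u + v * v) * p"
          "u * (v * p + u * q) - v * (u * p - v * q) = (u * u + v * v) * q"
          by (simp_all add: algebra_simps)
        then show "p = u * (u * p - v * q) + v * (v * p + u * q)"
          "q = u * (v * p + u * q) - v * (u * p - v * q)"
          by (simp_all only: that mult_1)
      qed
      show "l0 i = of_real (cos (\<theta> i)) * c $ 0 + of_real (sin (\<theta> i)) * c $ 1"
        "l1 i = of_real (cos (\<theta> i)) * c $ 1 - of_real (sin (\<theta> i)) * c $ 0"
        unfolding e0[OF that, symmetric] e1[OF that, symmetric]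
        by (rule rotate_back[OF sc])+
    qed
    define C S :: complex where "C = (\<Sum>i\<in>{1..n}. of_real (cos (\<theta> i)))"
      and "S = (\<Sum>i\<in>{1..n}. of_real (sin (\<theta> i)))"
    have "0 = (\<Sum>i\<in>{1..n}. l0 i)" unfolding l0_def V[symmetric] by (simp add: sum_lap_eq_0)
    also have "\<dots> = C * c $ 0 + S * c $ 1"
      by (simp add: l0 sum.distrib C_def S_def sum_distrib_right)
    finally have s0: "C * c $ 0 + S * c $ 1 = 0" by simp
    have "0 = (\<Sum>i\<in>{1..n}. l1 i)" unfolding l1_def V[symmetric] by (simp add: sum_lap_eq_0)
    also have "\<dots> = C * c $ 1 - S * c $ 0"
      by (simp add: l1 sum_subtractf C_def S_def sum_distrib_right)
    finally have s1: "C * c $ 1 - S * c $ 0 = 0" by simp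
    have "C * C + S * S \<noteq> 0"
    proof -
      have "C * C + S * S = of_real ((\<Sum>i\<in>{1..n}. cos (\<theta> i))\<^sup>2 + (\<Sum>i\<in>{1..n}. sin (\<theta> i))\<^sup>2)"
        by (simp add: C_def S_def power2_eq_square)
      moreover have "(\<Sum>i\<in>{1..n}. cos (\<theta> i))\<^sup>2 + (\<Sum>i\<in>{1..n}. sin (\<theta> i))\<^sup>2 \<noteq> 0"
        using C V by (simp add: sum_power2_eq_zero_iff)
      ultimately show ?thesis by (simp only: of_real_eq_0_iff not_False_eq_True)
    qed
    have "(C * C + S * S) * c $ 0 = C * (C * c $ 0 + S * c $ 1) - S * (C * c $ 1 - S * c $ 0)"
      "(C * C + S * S) * c $ 1 = S * (C * c $ 0 + S * c $ 1) + C * (C * c $ 1 - S * c $ 0)"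
      by (simp_all add: algebra_simps)
    then have "(C * C + S * S) * c $ 0 = 0" "(C * C + S * S) * c $ 1 = 0"
      by (simp_all only: s0 s1) simp_all
    with \<open>C * C + S * S \<noteq> 0\<close> have c0: "c $ 0 = 0" "c $ 1 = 0" by auto
    \<comment> \<open>The first two entries of \<open>?w\<close> are 0, so the constant value is the value 0 at vertex 1.\<close>
    have zero: "coord a ?w i = 0" if "a < 2" "i \<in> {1..n}" for a i
    proof -
      have "lap G (coord a ?w) j = 0" if "j \<in> pverts G" for j
        using l0[of j] l1[of j] c0 that V \<open>a < 2\<close> by (auto simp: l0_def l1_def less_2_cases_iff)
      then have "coord a ?w i = coord a ?w 1"
        using that V n by (intro lap_eq_0_imp_constant[OF conn]) auto
      then show ?thesis using \<open>a < 2\<close> by (simp add: coord_def)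
    qed
    then have "?w = 0\<^sub>v (2 * n)" by (intro vec_eq_0_if_coords_eq_0[OF w]) auto
    also have "\<dots> = 0\<^sub>v 2 @\<^sub>v 0\<^sub>v m" by (auto simp: nm)
    finally show "y = 0\<^sub>v m" by (subst (asm) append_vec_eq[of _ 2]) auto
  qed
qed

section \<open>Location of the spectrum\<close>

theorem theorem3:
  fixes n :: nat and G :: "nat pair_pre_digraph" and \<theta> :: "nat \<Rightarrow> real"
  assumes "pair_graph G"
    and "pverts G = {1..n}"
    and "Digraph_Component.connected (with_proj G)"
  shows "((\<forall>i\<in>{1..n}. 0 < cos (\<theta> i) \<and> cos (\<theta> i) \<le> 1) \<longrightarrow>
            order 0 (char_poly (Lout_complex n G \<theta>)) = 2 \<and>
            (\<forall>z. eigenvalue (Lout_complex n G \<theta>) z \<and> z \<noteq> 0 \<longrightarrow>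
                 z \<in> Rc G \<theta> \<inter> {z. 0 < Re z}))
       \<and> ((\<forall>i\<in>{1..n}. - 1 \<le> cos (\<theta> i) \<and> cos (\<theta> i) < 0) \<longrightarrow>
            order 0 (char_poly (Lout_complex n G \<theta>)) = 2 \<and>
            (\<forall>z. eigenvalue (Lout_complex n G \<theta>) z \<and> z \<noteq> 0 \<longrightarrow>
                 z \<in> Rc G \<theta> \<inter> {z. Re z < 0}))
       \<and> ((\<forall>i\<in>{1..n}. cos (\<theta> i) = 0) \<longrightarrow>
            (\<forall>z. eigenvalue (Lout_complex n G \<theta>) z \<longrightarrow> Re z = 0))"
proof -
  interpret pair_graph G by fact
  note V = \<open>pverts G = {1..n}\<close>
  have ne: "pverts G \<noteq> {}"
    using assms(3) by (auto simp: Digraph_Component.connected_def strongly_connected_def)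
  have order_2: "order 0 (char_poly (Lout_complex n G \<theta>)) = 2"
    if "(\<Sum>i\<in>pverts G. cos (\<theta> i)) \<noteq> 0"
    using order_0_char_poly_Lout[OF assms that] .
  have spectrum: "\<exists>x q v. 0 < q \<and> v \<in> pverts G \<and> x v \<noteq> (0 :: complex) \<and> z \<in> Rc G \<theta> \<and>
      (cmod z)\<^sup>2 * (\<Sum>i\<in>pverts G. cos (\<theta> i) * (cmod (x i))\<^sup>2) = q * Re z"
    if ev: "eigenvalue (Lout_complex n G \<theta>) z" and "z \<noteq> 0" for z
  proof -
    obtain x \<phi> v where \<phi>: "\<phi> = \<theta> \<or> \<phi> = (\<lambda>i. - \<theta> i)"
      and eigen: "\<And>i. i \<in> pverts G \<Longrightarrow> cis (\<phi> i) * lap G x i = z * x i"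
      and v: "v \<in> pverts G" "x v \<noteq> 0"
      by (rule Lout_eigenvalue_imp_rotated_eigen[OF assms(1,2) ev]) (rule that)
    have "z \<in> Rc G \<theta>"
      using rotated_eigen_Gershgorin[of \<phi> x z, OF eigen v] \<phi> by (auto intro: rotated_Gershgorin_disc_subset_Rc)
    moreover have "(cmod z)\<^sup>2 * (\<Sum>i\<in>pverts G. cos (\<theta> i) * (cmod (x i))\<^sup>2) = energy G x * Re z"
      using rotated_eigen_sign(2)[of \<phi> x z, OF eigen v \<open>z \<noteq> 0\<close>] \<phi> by auto
    moreover have "0 < energy G x"
      using rotated_eigen_sign(1)[of \<phi> x z, OF eigen v \<open>z \<noteq> 0\<close>] .
    ultimately show ?thesis using v by (intro exI[of _ x] exI[of _ "energy G x"] exI[of _ v]) simp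
  qed
  have weighted_sum_pos: "0 < (\<Sum>i\<in>pverts G. f i * (cmod (x i))\<^sup>2)"
    if "\<And>i. i \<in> pverts G \<Longrightarrow> 0 < f i" "v \<in> pverts G" "x v \<noteq> 0" for f x v
  proof (rule sum_pos2[of _ v])
    show "0 \<le> f i * (cmod (x i))\<^sup>2" if "i \<in> pverts G" for i
      using \<open>\<And>i. i \<in> pverts G \<Longrightarrow> 0 < f i\<close>[OF that] by simp
  qed (use that pair_finite_verts in auto)
  show ?thesis
  proof (intro conjI impI allI)
    assume pos: "\<forall>i\<in>{1..n}. 0 < cos (\<theta> i) \<and> cos (\<theta> i) \<le> 1"
    have "0 < (\<Sum>i\<in>pverts G. cos (\<theta> i))"
      using pos V ne pair_finite_verts by (intro sum_pos) auto
    then show "order 0 (char_poly (Lout_complex n G \<theta>)) = 2" by (intro order_2) simp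
    fix z assume z: "eigenvalue (Lout_complex n G \<theta>) z \<and> z \<noteq> 0"
    then obtain x q v where "0 < q" and xv: "v \<in> pverts G" "x v \<noteq> (0 :: complex)" and R: "z \<in> Rc G \<theta>"
      and eq: "(cmod z)\<^sup>2 * (\<Sum>i\<in>pverts G. cos (\<theta> i) * (cmod (x i))\<^sup>2) = q * Re z"
      using spectrum by blast
    have "0 < (\<Sum>i\<in>pverts G. cos (\<theta> i) * (cmod (x i))\<^sup>2)"
      using weighted_sum_pos[of "\<lambda>i. cos (\<theta> i)" v x] pos V xv by auto
    then have "0 < q * Re z" unfolding eq[symmetric] using z by (intro mult_pos_pos) auto
    with \<open>0 < q\<close> R show "z \<in> Rc G \<theta> \<inter> {z. 0 < Re z}" by (simp add: zero_less_mult_iff)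
  next
    assume neg: "\<forall>i\<in>{1..n}. - 1 \<le> cos (\<theta> i) \<and> cos (\<theta> i) < 0"
    have "0 < (\<Sum>i\<in>pverts G. - cos (\<theta> i))"
      using neg V ne pair_finite_verts by (intro sum_pos) auto
    then show "order 0 (char_poly (Lout_complex n G \<theta>)) = 2" by (intro order_2) (simp add: sum_negf)
    fix z assume z: "eigenvalue (Lout_complex n G \<theta>) z \<and> z \<noteq> 0"
    then obtain x q v where "0 < q" and xv: "v \<in> pverts G" "x v \<noteq> (0 :: complex)" and R: "z \<in> Rc G \<theta>"
      and eq: "(cmod z)\<^sup>2 * (\<Sum>i\<in>pverts G. cos (\<theta> i) * (cmod (x i))\<^sup>2) = q * Re z"
      using spectrum by blast
    have "(\<Sum>i\<in>pverts G. cos (\<theta> i) * (cmod (x i))\<^sup>2) < 0"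
      using weighted_sum_pos[of "\<lambda>i. - cos (\<theta> i)" v x] neg V xv by (auto simp: sum_negf)
    then have "q * Re z < 0" unfolding eq[symmetric] using z by (intro mult_pos_neg) auto
    with \<open>0 < q\<close> R show "z \<in> Rc G \<theta> \<inter> {z. Re z < 0}" by (simp add: mult_less_0_iff)
  next
    assume zero: "\<forall>i\<in>{1..n}. cos (\<theta> i) = 0"
    fix z assume "eigenvalue (Lout_complex n G \<theta>) z"
    then show "Re z = 0"
      using spectrum[of z] zero V by (cases "z = 0") auto
  qed
qed

end
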